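(* For every $n\ge1$, $\mathrm{ex}_<(n,P_4^{132})=\mathrm{ex}_<(n,P_4^{213})=\left\lfloor \frac32(n-1)\right\rfloor$.
   Context: Edge-ordered graph: finite simple graph with a linear order on its edges; isomorphisms preserve order; subgraphs carry induced order; $\mathrm{ex}_<(n,H)$ is the maximum number of edges of an edge-ordered graph on $n$ vertices with no subgraph isomorphic to $H$. Notation: $P_k^{a_1a_2\dots a_{k-1}}$ denotes the path $v_1v_2\dots v_k$ in which edge $v_iv_{i+1}$ has label $a_i$, edges being ordered by label. So $P_4^{132}$ is $v_1v_2v_3v_4$ with $v_1v_2<v_3v_4<v_2v_3$, and $P_4^{213}$ has $v_2v_3<v_1v_2<v_3v_4$. *)

theory Defs
  imports Complex_Main
begin

text \<open>Edges are two-element vertex sets; the edge order is a reflexive linear order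
  whose field is exactly the edge set.\<close>

record 'a edge_ordered_graph =
  verts :: "'a set"
  edges :: "'a set set"
  edge_order :: "'a set rel"

definition edge_ordered_graph :: "'a edge_ordered_graph \<Rightarrow> bool" where
  "edge_ordered_graph G \<longleftrightarrow>
     finite (verts G) \<and>
     edges G \<subseteq> {e. e \<subseteq> verts G \<and> card e = 2} \<and>
     linear_order_on (edges G) (edge_order G)"

definition eo_subgraph :: "'a edge_ordered_graph \<Rightarrow> 'a edge_ordered_graph \<Rightarrow> bool" where
  "eo_subgraph K G \<longleftrightarrow>
     edge_ordered_graph K \<and> edge_ordered_graph G \<and>
     verts K \<subseteq> verts G \<and> edges K \<subseteq> edges G \<and>
     edge_order K = edge_order G \<inter> (edges K \<times> edges K)"

definition eo_isomorphic :: "'a edge_ordered_graph \<Rightarrow> 'b edge_ordered_graph \<Rightarrow> bool" where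
  "eo_isomorphic G H \<longleftrightarrow>
     (\<exists>f. bij_betw f (verts G) (verts H) \<and>
          (\<forall>u\<in>verts G. \<forall>v\<in>verts G. {u, v} \<in> edges G \<longleftrightarrow> {f u, f v} \<in> edges H) \<and>
          (\<forall>e\<in>edges G. \<forall>e'\<in>edges G.
             (e, e') \<in> edge_order G \<longleftrightarrow> (f ` e, f ` e') \<in> edge_order H))"

definition eo_contains :: "'a edge_ordered_graph \<Rightarrow> 'b edge_ordered_graph \<Rightarrow> bool" where
  "eo_contains G H \<longleftrightarrow> (\<exists>K. eo_subgraph K G \<and> eo_isomorphic K H)"

text \<open>Every finite graph has an isomorphic copy with vertices in \<^typ>\<open>nat\<close>, so host graphs
  range over that vertex type only. The maximum is over a finite set, which is nonempty
  whenever \<open>H\<close> has an edge (see the two lemmas at the end).\<close>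

definition ex_less :: "nat \<Rightarrow> 'b edge_ordered_graph \<Rightarrow> nat" where
  "ex_less n H = Max {card (edges G) | G :: nat edge_ordered_graph.
     edge_ordered_graph G \<and> card (verts G) = n \<and> \<not> eo_contains G H}"

text \<open>For \<open>as = [a\<^sub>1, \<dots>, a\<^sub>m]\<close> with distinct entries: the path on the vertices
  \<open>1, \<dots>, m + 1\<close> in which the edge \<open>{i, i + 1}\<close> has label \<open>a\<^sub>i = as ! (i - 1)\<close>,
  with edges ordered by label.\<close>

definition eo_path :: "nat list \<Rightarrow> nat edge_ordered_graph" where
  "eo_path as =
     \<lparr>verts = {1..length as + 1},
      edges = {{i, i + 1} | i. i \<in> {1..length as}},
      edge_order = {({i, i + 1}, {j, j + 1}) | i j.
        i \<in> {1..length as} \<and> j \<in> {1..length as} \<and> as ! (i - 1) \<le> as ! (j - 1)}\<rparr>"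

lemma edge_ordered_graph_eo_path:
  assumes "distinct as"
  shows "edge_ordered_graph (eo_path as)"
proof -
  have inj: "i = j" if "{i, Suc i} = {j, Suc j}" for i j :: nat
    using that by (metis doubleton_eq_iff n_not_Suc_n Suc_n_not_le_n le_SucI order_refl)
  have nth: "i = j" if "i \<in> {1..length as}" "j \<in> {1..length as}"
    "as ! (i - 1) = as ! (j - 1)" for i j
  proof -
    have "i - 1 = j - 1"
      using that assms by (subst nth_eq_iff_index_eq[symmetric, of as]) auto
    then show ?thesis using that by auto
  qed
  let ?E = "edges (eo_path as)" and ?r = "edge_order (eo_path as)"
  have r: "({i, Suc i}, {j, Suc j}) \<in> ?r \<longleftrightarrow>
      i \<in> {1..length as} \<and> j \<in> {1..length as} \<and> as ! (i - 1) \<le> as ! (j - 1)" for i j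
    unfolding eo_path_def by (auto dest!: inj)
  have rE: "\<exists>i j. x = ({i, Suc i}, {j, Suc j}) \<and> i \<in> {1..length as} \<and> j \<in> {1..length as}"
    if "x \<in> ?r" for x
    using that unfolding eo_path_def by auto
  have E: "?E = (\<lambda>i. {i, Suc i}) ` {1..length as}"
    unfolding eo_path_def by auto
  have "?r \<subseteq> ?E \<times> ?E"
    using rE unfolding E by fastforce
  moreover have "refl_on ?E ?r"
    unfolding E by (auto simp: refl_on_def r)
  moreover have "trans ?r"
  proof (rule transI)
    fix x y z assume xy: "(x, y) \<in> ?r" and yz: "(y, z) \<in> ?r"
    obtain i j where ij: "x = {i, Suc i}" "y = {j, Suc j}" using rE[OF xy] by auto
    obtain k where k: "z = {k, Suc k}" using rE[OF yz] by auto
    show "(x, z) \<in> ?r" using xy yz unfolding ij k r by auto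
  qed
  moreover have "antisym ?r"
  proof (rule antisymI)
    fix x y assume xy: "(x, y) \<in> ?r" and yx: "(y, x) \<in> ?r"
    obtain i j where ij: "x = {i, Suc i}" "y = {j, Suc j}" using rE[OF xy] by auto
    show "x = y" using xy yx nth[of i j] unfolding ij r by auto
  qed
  moreover have "total_on ?E ?r"
    unfolding E by (auto simp: total_on_def r)
  ultimately have "linear_order_on ?E ?r"
    unfolding order_on_defs by blast
  moreover have "finite (verts (eo_path as))"
    "?E \<subseteq> {e. e \<subseteq> verts (eo_path as) \<and> card e = 2}"
    unfolding eo_path_def by auto
  ultimately show ?thesis
    unfolding edge_ordered_graph_def by blast
qed

lemma finite_ex_less_set:
  "finite {card (edges G) | G :: nat edge_ordered_graph.
     edge_ordered_graph G \<and> card (verts G) = n \<and> \<not> eo_contains G H}" (is "finite ?S")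
proof (rule finite_subset)
  show "?S \<subseteq> {..2 ^ n}"
  proof clarsimp
    fix G :: "nat edge_ordered_graph"
    assume "edge_ordered_graph G"
    then have "finite (verts G)" "edges G \<subseteq> Pow (verts G)"
      unfolding edge_ordered_graph_def by auto
    then have "card (edges G) \<le> card (Pow (verts G))"
      by (intro card_mono) auto
    then show "card (edges G) \<le> 2 ^ card (verts G)"
      using \<open>finite (verts G)\<close> by (simp add: card_Pow)
  qed
qed simp

lemma ex_less_set_nonempty:
  assumes "edge_ordered_graph H" "edges H \<noteq> {}"
  shows "{card (edges G) | G :: nat edge_ordered_graph.
     edge_ordered_graph G \<and> card (verts G) = n \<and> \<not> eo_contains G H} \<noteq> {}"
proof -
  let ?G = "\<lparr>verts = {..<n}, edges = {}, edge_order = {}\<rparr> :: nat edge_ordered_graph"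
  have "edge_ordered_graph ?G"
    unfolding edge_ordered_graph_def order_on_defs by (auto simp: refl_on_def total_on_def)
  moreover have "\<not> eo_contains ?G H"
  proof
    assume "eo_contains ?G H"
    then obtain K :: "nat edge_ordered_graph" where K: "edges K = {}" "eo_isomorphic K H"
      unfolding eo_contains_def eo_subgraph_def by auto
    then obtain f where f: "bij_betw f (verts K) (verts H)"
      "\<And>u v. u \<in> verts K \<Longrightarrow> v \<in> verts K \<Longrightarrow> {f u, f v} \<notin> edges H"
      unfolding eo_isomorphic_def by auto
    obtain e where e: "e \<in> edges H" "e \<subseteq> verts H" "card e = 2"
      using assms unfolding edge_ordered_graph_def by blast
    then obtain x y where "e = {x, y}" by (auto simp: card_2_iff)
    moreover from this e f(1) obtain u v where "u \<in> verts K" "v \<in> verts K" "x = f u" "y = f v"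
      unfolding bij_betw_def by (metis imageE insert_subset)
    ultimately show False using e(1) f(2) by blast
  qed
  ultimately show ?thesis by fastforce
qed

end

theory Submission
  imports Defs
begin

text \<open>A graph avoids \<open>P\<^sub>4\<^sup>1\<^sup>3\<^sup>2\<close> iff no path on four vertices has its middle edge largest. Insert
  the edges in increasing order: each new edge either meets a so far isolated vertex, or it joins
  two vertices of degree one with the same neighbour. Giving a vertex of degree \<open>d\<close> the weight
  \<open>min 3 (2 d)\<close>, every insertion raises the total weight by at least 2, with an excess of 2 at the
  first edge and of 1 when the first vertex of degree two appears; the total weight is at most
  \<open>3 n\<close>. Triangles sharing one vertex, with the edges at that vertex smallest, attain
  the bound. Reversing the edge order exchanges \<open>P\<^sub>4\<^sup>1\<^sup>3\<^sup>2\<close> and \<open>P\<^sub>4\<^sup>2\<^sup>1\<^sup>3\<close>.\<close>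

section \<open>Containment as an order-preserving embedding\<close>

lemma linear_order_on_restrict:
  assumes "linear_order_on A r" "B \<subseteq> A"
  shows "linear_order_on B (r \<inter> (B \<times> B))"
proof -
  have A: "refl_on A r" "trans r" "antisym r" "total_on A r"
    using assms(1) unfolding order_on_defs by auto
  have "refl_on B (r \<inter> (B \<times> B))"
    using A(1) assms(2) by (auto simp: refl_on_def)
  moreover have "trans (r \<inter> (B \<times> B))"
    using A(2) by (auto intro!: transI dest: transD)
  moreover have "antisym (r \<inter> (B \<times> B))"
    using A(3) by (auto intro!: antisymI dest: antisymD)
  moreover have "total_on B (r \<inter> (B \<times> B))"
    using A(4) assms(2) by (auto simp: total_on_def)
  ultimately show ?thesis unfolding order_on_defs by auto
qed

text \<open>Replaces the search for a subgraph \<open>K\<close> by the search for one injection. The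
  inverse of an isomorphism from \<open>K\<close> to \<open>H\<close> is such an embedding;
  conversely, the image of \<open>H\<close> under an embedding, with the order induced from
  \<open>G\<close>, serves as \<open>K\<close>. Non-edges of \<open>H\<close> are unconstrained,
  because subgraphs need not be induced.\<close>

lemma eo_contains_iff_embedding:
  assumes G: "edge_ordered_graph G" and H: "edge_ordered_graph H"
  shows "eo_contains G H \<longleftrightarrow>
    (\<exists>p. inj_on p (verts H) \<and> p ` verts H \<subseteq> verts G \<and> (\<forall>e\<in>edges H. p ` e \<in> edges G) \<and>
      (\<forall>e\<in>edges H. \<forall>e'\<in>edges H.
        (e, e') \<in> edge_order H \<longleftrightarrow> (p ` e, p ` e') \<in> edge_order G))"
    (is "_ \<longleftrightarrow> (\<exists>p. ?emb p)")
proof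
  assume "eo_contains G H"
  then obtain K f where K: "eo_subgraph K G" and f: "bij_betw f (verts K) (verts H)"
    and fE: "\<And>u v. u \<in> verts K \<Longrightarrow> v \<in> verts K \<Longrightarrow> {u, v} \<in> edges K \<longleftrightarrow> {f u, f v} \<in> edges H"
    and fO: "\<And>e e'. e \<in> edges K \<Longrightarrow> e' \<in> edges K \<Longrightarrow>
      (e, e') \<in> edge_order K \<longleftrightarrow> (f ` e, f ` e') \<in> edge_order H"
    unfolding eo_contains_def eo_isomorphic_def by blast
  define p where "p = inv_into (verts K) f"
  have p: "bij_betw p (verts H) (verts K)"
    unfolding p_def by (rule bij_betw_inv_into[OF f])
  have fp: "f (p v) = v" if "v \<in> verts H" for v
    unfolding p_def using f that by (rule bij_betw_inv_into_right)
  have pK: "p v \<in> verts K" if "v \<in> verts H" for v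
    using p that by (rule bij_betwE[THEN bspec])
  have edge: "p ` e \<in> edges K \<and> f ` p ` e = e" if "e \<in> edges H" for e
  proof -
    from that H obtain u v where uv: "e = {u, v}" "u \<in> verts H" "v \<in> verts H"
      unfolding edge_ordered_graph_def by (force simp: card_2_iff)
    then show ?thesis using that fE[of "p u" "p v"] by (simp add: pK fp)
  qed
  have "?emb p"
  proof (intro conjI ballI)
    show "inj_on p (verts H)" using p by (rule bij_betw_imp_inj_on)
    show "p ` verts H \<subseteq> verts G" using K pK unfolding eo_subgraph_def by auto
    show "p ` e \<in> edges G" if "e \<in> edges H" for e
      using K edge[OF that] unfolding eo_subgraph_def by auto
    show "(e, e') \<in> edge_order H \<longleftrightarrow> (p ` e, p ` e') \<in> edge_order G"
      if "e \<in> edges H" "e' \<in> edges H" for e e'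
      using K fO[of "p ` e" "p ` e'"] edge[OF that(1)] edge[OF that(2)]
      unfolding eo_subgraph_def by auto
  qed
  then show "\<exists>p. ?emb p" by (intro exI[of _ p])
next
  assume "\<exists>p. ?emb p"
  then obtain p where p: "?emb p" ..
  define K where "K = \<lparr>verts = p ` verts H, edges = (`) p ` edges H,
    edge_order = edge_order G \<inter> ((`) p ` edges H \<times> (`) p ` edges H)\<rparr>"
  have sub: "e \<subseteq> verts H" "card e = 2" if "e \<in> edges H" for e
    using H that unfolding edge_ordered_graph_def by auto
  have EK: "edges K \<subseteq> edges G" using p unfolding K_def by auto
  have "linear_order_on (edges K) (edge_order K)"
    using G EK linear_order_on_restrict[of "edges G" "edge_order G" "edges K"]
    unfolding edge_ordered_graph_def by (simp add: K_def)
  moreover have "edges K \<subseteq> {e. e \<subseteq> verts K \<and> card e = 2}"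
    using sub p unfolding K_def by (auto simp: card_image inj_on_subset)
  ultimately have "edge_ordered_graph K"
    using H unfolding edge_ordered_graph_def by (simp add: K_def)
  then have "eo_subgraph K G"
    using G EK p unfolding eo_subgraph_def by (simp add: K_def)
  moreover have "eo_isomorphic K H"
  proof -
    define f where "f = inv_into (verts H) p"
    have fp: "f (p v) = v" if "v \<in> verts H" for v
      using p that unfolding f_def by simp
    have fpe: "f ` p ` e = e" if "e \<subseteq> verts H" for e
      using fp that by (force simp: image_image)
    have "bij_betw f (verts K) (verts H)"
      unfolding f_def K_def using p by (simp add: bij_betw_inv_into inj_on_imp_bij_betw)
    moreover have "{u, v} \<in> edges K \<longleftrightarrow> {f u, f v} \<in> edges H"
      if uv: "u \<in> verts K" "v \<in> verts K" for u v
    proof -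
      obtain a b where ab: "u = p a" "v = p b" "a \<in> verts H" "b \<in> verts H"
        using uv unfolding K_def by auto
      \<comment> \<open>An edge of \<open>K\<close> is known only as the image of some edge
        \<open>e\<close> of \<open>H\<close>. Since \<open>f\<close> undoes \<open>p\<close>, equal
        images force \<open>e = {a, b}\<close>.\<close>
      have "p ` {a, b} \<in> (`) p ` edges H \<longleftrightarrow> {a, b} \<in> edges H"
      proof
        assume "p ` {a, b} \<in> (`) p ` edges H"
        then obtain e where e: "e \<in> edges H" "p ` {a, b} = p ` e" by blast
        then have "f ` p ` {a, b} = f ` p ` e" by simp
        then have "{a, b} = e" using fpe[of "{a, b}"] fpe[of e] sub(1)[OF e(1)] ab by simp
        then show "{a, b} \<in> edges H" using e(1) by simp
      qed (rule imageI)
      then show ?thesis using ab fp by (simp add: K_def)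
    qed
    moreover have "(e, e') \<in> edge_order K \<longleftrightarrow> (f ` e, f ` e') \<in> edge_order H"
      if "e \<in> edges K" "e' \<in> edges K" for e e'
      using that p fpe sub unfolding K_def by auto
    ultimately show ?thesis unfolding eo_isomorphic_def by blast
  qed
  ultimately show "eo_contains G H" unfolding eo_contains_def by blast
qed

section \<open>Containment of a four-vertex path in terms of its vertices\<close>

lemma edges_eo_path3: "edges (eo_path [a, b, c]) = {{1, 2}, {2, 3}, {3, 4}}"
proof -
  have "edges (eo_path [a, b, c]) = (\<lambda>i. {i, i + 1}) ` {1..length [a, b, c]}"
    unfolding eo_path_def by auto
  also have "{1..length [a, b, c]} = {1, 2, 3}" by auto
  finally show ?thesis by (simp add: numeral_eq_Suc)
qed

lemma edge_order_eo_path_iff: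
  assumes "i \<in> {1..length as}" "j \<in> {1..length as}"
  shows "({i, i + 1}, {j, j + 1}) \<in> edge_order (eo_path as) \<longleftrightarrow> as ! (i - 1) \<le> as ! (j - 1)"
proof -
  have inj: "k = l" if "{k, Suc k} = {l, Suc l}" for k l :: nat
    using that by (auto simp: doubleton_eq_iff)
  show ?thesis using assms unfolding eo_path_def by (auto dest!: inj)
qed

lemma edge_order_flip:
  assumes "edge_ordered_graph G" "e \<in> edges G" "f \<in> edges G" "e \<noteq> f"
  shows "(e, f) \<in> edge_order G \<longleftrightarrow> (f, e) \<notin> edge_order G"
  using assms unfolding edge_ordered_graph_def order_on_defs total_on_def antisym_def by blast

text \<open>Three comparisons determine the whole order on the three edges: labels are distinct and
  the edges of a path are distinct, so each reversed comparison is the negation of a listed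
  one.\<close>

lemma eo_contains_path3_iff:
  assumes G: "edge_ordered_graph G" and "distinct [a, b, c]"
  shows "eo_contains G (eo_path [a, b, c]) \<longleftrightarrow>
    (\<exists>x y z w. distinct [x, y, z, w] \<and> {x, y} \<in> edges G \<and> {y, z} \<in> edges G \<and> {z, w} \<in> edges G \<and>
      (({x, y}, {y, z}) \<in> edge_order G \<longleftrightarrow> a \<le> b) \<and>
      (({y, z}, {z, w}) \<in> edge_order G \<longleftrightarrow> b \<le> c) \<and>
      (({x, y}, {z, w}) \<in> edge_order G \<longleftrightarrow> a \<le> c))" (is "_ \<longleftrightarrow> ?rhs")
proof -
  let ?H = "eo_path [a, b, c]"
  have V: "verts ?H = {1, 2, 3, 4}" unfolding eo_path_def by auto
  have O: "({1, 2}, {2, 3}) \<in> edge_order ?H \<longleftrightarrow> a \<le> b"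
    "({2, 3}, {3, 4}) \<in> edge_order ?H \<longleftrightarrow> b \<le> c"
    "({1, 2}, {3, 4}) \<in> edge_order ?H \<longleftrightarrow> a \<le> c"
    "({2, 3}, {1, 2}) \<in> edge_order ?H \<longleftrightarrow> b \<le> a"
    "({3, 4}, {2, 3}) \<in> edge_order ?H \<longleftrightarrow> c \<le> b"
    "({3, 4}, {1, 2}) \<in> edge_order ?H \<longleftrightarrow> c \<le> a"
    "({1, 2}, {1, 2}) \<in> edge_order ?H"
    "({2, 3}, {2, 3}) \<in> edge_order ?H"
    "({3, 4}, {3, 4}) \<in> edge_order ?H"
    using edge_order_eo_path_iff[of 1 "[a, b, c]" 2] edge_order_eo_path_iff[of 2 "[a, b, c]" 3]
      edge_order_eo_path_iff[of 1 "[a, b, c]" 3] edge_order_eo_path_iff[of 2 "[a, b, c]" 1]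
      edge_order_eo_path_iff[of 3 "[a, b, c]" 2] edge_order_eo_path_iff[of 3 "[a, b, c]" 1]
      edge_order_eo_path_iff[of 1 "[a, b, c]" 1] edge_order_eo_path_iff[of 2 "[a, b, c]" 2]
      edge_order_eo_path_iff[of 3 "[a, b, c]" 3]
    by (simp_all add: Suc_1 del: One_nat_def)
  have lin: "linear_order_on (edges G) (edge_order G)"
    and sub: "\<And>e. e \<in> edges G \<Longrightarrow> e \<subseteq> verts G"
    using G unfolding edge_ordered_graph_def by auto
  have refl: "(e, e) \<in> edge_order G" if "e \<in> edges G" for e
    using lin that unfolding order_on_defs refl_on_def by auto
  note flip = edge_order_flip[OF G]
  show ?thesis
    unfolding eo_contains_iff_embedding[OF G edge_ordered_graph_eo_path[OF assms(2)]]
  proof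
    assume "\<exists>p. inj_on p (verts ?H) \<and> p ` verts ?H \<subseteq> verts G \<and> (\<forall>e\<in>edges ?H. p ` e \<in> edges G) \<and>
      (\<forall>e\<in>edges ?H. \<forall>e'\<in>edges ?H. (e, e') \<in> edge_order ?H \<longleftrightarrow> (p ` e, p ` e') \<in> edge_order G)"
    then obtain p where inj: "inj_on p {1, 2, 3, 4}"
      and E: "\<forall>e\<in>edges ?H. p ` e \<in> edges G"
      and ord: "\<forall>e\<in>edges ?H. \<forall>e'\<in>edges ?H.
        (e, e') \<in> edge_order ?H \<longleftrightarrow> (p ` e, p ` e') \<in> edge_order G"
      unfolding V by blast
    have "distinct [p 1, p 2, p 3, p 4]" using inj by (auto simp: inj_on_def)
    then show ?rhs using E ord unfolding edges_eo_path3
      by (intro exI[of _ "p 1"] exI[of _ "p 2"] exI[of _ "p 3"] exI[of _ "p 4"]) (simp add: O del: One_nat_def)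
  next
    assume ?rhs
    then obtain x y z w where d: "distinct [x, y, z, w]"
      and E: "{x, y} \<in> edges G" "{y, z} \<in> edges G" "{z, w} \<in> edges G"
      and ord: "({x, y}, {y, z}) \<in> edge_order G \<longleftrightarrow> a \<le> b"
        "({y, z}, {z, w}) \<in> edge_order G \<longleftrightarrow> b \<le> c"
        "({x, y}, {z, w}) \<in> edge_order G \<longleftrightarrow> a \<le> c"
      by blast
    \<comment> \<open>The reversed comparisons, by totality and antisymmetry; an embedding must
      respect these as well.\<close>
    have ord': "({y, z}, {x, y}) \<in> edge_order G \<longleftrightarrow> b \<le> a"
      "({z, w}, {y, z}) \<in> edge_order G \<longleftrightarrow> c \<le> b"
      "({z, w}, {x, y}) \<in> edge_order G \<longleftrightarrow> c \<le> a"
      using ord d E assms(2) flip[of "{y, z}" "{x, y}"] flip[of "{z, w}" "{y, z}"]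
        flip[of "{z, w}" "{x, y}"]
      by (auto simp: doubleton_eq_iff)
    define p where "p i = (if i = 1 then x else if i = 2 then y else if i = 3 then z else w)"
      for i :: nat
    have p: "p 1 = x" "p 2 = y" "p 3 = z" "p 4 = w" by (simp_all add: p_def)
    have "inj_on p (verts ?H)" "p ` verts ?H \<subseteq> verts G"
      using d sub[OF E(1)] sub[OF E(3)] unfolding V by (auto simp: inj_on_def p_def)
    then show "\<exists>p. inj_on p (verts ?H) \<and> p ` verts ?H \<subseteq> verts G \<and>
      (\<forall>e\<in>edges ?H. p ` e \<in> edges G) \<and>
      (\<forall>e\<in>edges ?H. \<forall>e'\<in>edges ?H. (e, e') \<in> edge_order ?H \<longleftrightarrow> (p ` e, p ` e') \<in> edge_order G)"
      using E ord ord' refl unfolding edges_eo_path3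
      by (intro exI[of _ p]) (simp add: O p del: One_nat_def)
  qed
qed

text \<open>Only the maximality of the middle edge matters: whichever outer edge is smaller, reading
  the path from that end gives the labels 1, 3, 2.\<close>

lemma eo_contains_path_132_iff:
  assumes G: "edge_ordered_graph G"
  shows "eo_contains G (eo_path [1, 3, 2]) \<longleftrightarrow>
    (\<exists>x y z w. distinct [x, y, z, w] \<and> {x, y} \<in> edges G \<and> {y, z} \<in> edges G \<and> {z, w} \<in> edges G \<and>
      ({x, y}, {y, z}) \<in> edge_order G \<and> ({z, w}, {y, z}) \<in> edge_order G)" (is "_ \<longleftrightarrow> ?rhs")
proof -
  note flip = edge_order_flip[OF G]
  have "distinct [1, 3, 2 :: nat]" by simp
  note iff = eo_contains_path3_iff[OF G this]
  show ?thesis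
  proof
    assume "eo_contains G (eo_path [1, 3, 2])"
    then obtain x y z w where d: "distinct [x, y, z, w]"
      and E: "{x, y} \<in> edges G" "{y, z} \<in> edges G" "{z, w} \<in> edges G"
      and o: "({x, y}, {y, z}) \<in> edge_order G" "({y, z}, {z, w}) \<notin> edge_order G"
      unfolding iff by auto
    then have "({z, w}, {y, z}) \<in> edge_order G"
      using flip[OF E(2,3)] by (auto simp: doubleton_eq_iff)
    then show ?rhs using d E o by blast
  next
    assume ?rhs
    then obtain x y z w where d: "distinct [x, y, z, w]"
      and E: "{x, y} \<in> edges G" "{y, z} \<in> edges G" "{z, w} \<in> edges G"
      and o: "({x, y}, {y, z}) \<in> edge_order G" "({z, w}, {y, z}) \<in> edge_order G"
      by blast
    have ne: "{x, y} \<noteq> {y, z}" "{y, z} \<noteq> {z, w}" "{x, y} \<noteq> {z, w}"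
      using d by (auto simp: doubleton_eq_iff)
    show "eo_contains G (eo_path [1, 3, 2])"
    proof (cases "({x, y}, {z, w}) \<in> edge_order G")
      case True
      then show ?thesis unfolding iff using d E o flip[OF E(2,3) ne(2)]
        by (intro exI[of _ x] exI[of _ y] exI[of _ z] exI[of _ w]) simp
    next
      case False
      \<comment> \<open>Here the far outer edge is the smaller one, so the witness is the path read
        backwards.\<close>
      then have "({z, w}, {x, y}) \<in> edge_order G" using flip[OF E(1,3) ne(3)] by simp
      then show ?thesis unfolding iff using d E o flip[OF E(1,2) ne(1)]
        by (intro exI[of _ w] exI[of _ z] exI[of _ y] exI[of _ x]) (auto simp: insert_commute)
    qed
  qed
qed

section \<open>Reversing the edge order\<close>

lemma edge_ordered_graph_converse:
  "edge_ordered_graph (G\<lparr>edge_order := (edge_order G)\<inverse>\<rparr>) \<longleftrightarrow> edge_ordered_graph (G :: 'a edge_ordered_graph)"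
  by (simp add: edge_ordered_graph_def)

text \<open>Reversing the order replaces each label \<open>a\<close> by \<open>4 - a\<close>, so 2,
  1, 3 becomes 2, 3, 1, which is 1, 3, 2 when read from the other end. Hence both directions use the
  reversed vertex sequence as witness.\<close>

lemma eo_contains_path_213_converse:
  assumes G: "edge_ordered_graph (G :: 'a edge_ordered_graph)"
  shows "eo_contains G (eo_path [2, 1, 3]) \<longleftrightarrow>
    eo_contains (G\<lparr>edge_order := (edge_order G)\<inverse>\<rparr>) (eo_path [1, 3, 2])" (is "_ = eo_contains ?G _")
proof -
  note flip = edge_order_flip[OF G]
  have G': "edge_ordered_graph ?G" using G by (simp add: edge_ordered_graph_converse)
  have d1: "distinct [1, 3, 2 :: nat]" and d2: "distinct [2, 1, 3 :: nat]" by simp_all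
  have eq: "({x, y}, {y, z}) \<notin> edge_order G \<and> ({y, z}, {z, w}) \<in> edge_order G \<and>
      ({x, y}, {z, w}) \<in> edge_order G \<longleftrightarrow>
      ({z, w}, {y, z}) \<notin> edge_order G \<and> ({y, z}, {x, y}) \<in> edge_order G \<and>
      ({x, y}, {z, w}) \<in> edge_order G"
    if "distinct [x, y, z, w]" "{x, y} \<in> edges G" "{y, z} \<in> edges G" "{z, w} \<in> edges G" for x y z w
    using that flip[of "{x, y}" "{y, z}"] flip[of "{z, w}" "{y, z}"]
    by (auto simp: doubleton_eq_iff)
  show ?thesis
    unfolding eo_contains_path3_iff[OF G d2] eo_contains_path3_iff[OF G' d1]
  proof (intro iffI; elim exE conjE)
    fix x y z w
    assume "distinct [x, y, z, w]" "{x, y} \<in> edges G" "{y, z} \<in> edges G" "{z, w} \<in> edges G"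
      "({x, y}, {y, z}) \<in> edge_order G \<longleftrightarrow> (2::nat) \<le> 1"
      "({y, z}, {z, w}) \<in> edge_order G \<longleftrightarrow> (1::nat) \<le> 3"
      "({x, y}, {z, w}) \<in> edge_order G \<longleftrightarrow> (2::nat) \<le> 3"
    then show "\<exists>x y z w. distinct [x, y, z, w] \<and> {x, y} \<in> edges ?G \<and> {y, z} \<in> edges ?G \<and>
      {z, w} \<in> edges ?G \<and> (({x, y}, {y, z}) \<in> edge_order ?G \<longleftrightarrow> (1::nat) \<le> 3) \<and>
      (({y, z}, {z, w}) \<in> edge_order ?G \<longleftrightarrow> (3::nat) \<le> 2) \<and>
      (({x, y}, {z, w}) \<in> edge_order ?G \<longleftrightarrow> (1::nat) \<le> 2)"
      using eq[of x y z w]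
      by (intro exI[of _ w] exI[of _ z] exI[of _ y] exI[of _ x]) (auto simp: insert_commute)
  next
    fix x y z w
    assume "distinct [x, y, z, w]" "{x, y} \<in> edges ?G" "{y, z} \<in> edges ?G" "{z, w} \<in> edges ?G"
      "({x, y}, {y, z}) \<in> edge_order ?G \<longleftrightarrow> (1::nat) \<le> 3"
      "({y, z}, {z, w}) \<in> edge_order ?G \<longleftrightarrow> (3::nat) \<le> 2"
      "({x, y}, {z, w}) \<in> edge_order ?G \<longleftrightarrow> (1::nat) \<le> 2"
    then show "\<exists>x y z w. distinct [x, y, z, w] \<and> {x, y} \<in> edges G \<and> {y, z} \<in> edges G \<and>
      {z, w} \<in> edges G \<and> (({x, y}, {y, z}) \<in> edge_order G \<longleftrightarrow> (2::nat) \<le> 1) \<and>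
      (({y, z}, {z, w}) \<in> edge_order G \<longleftrightarrow> (1::nat) \<le> 3) \<and>
      (({x, y}, {z, w}) \<in> edge_order G \<longleftrightarrow> (2::nat) \<le> 3)"
      using eq[of w z y x]
      by (intro exI[of _ w] exI[of _ z] exI[of _ y] exI[of _ x]) (auto simp: insert_commute)
  qed
qed

text \<open>Order reversal is an involution that keeps vertices and edges, so the two families of
  avoiding graphs realise the same edge counts.\<close>

lemma ex_less_path_213_eq_132: "ex_less n (eo_path [2, 1, 3]) = ex_less n (eo_path [1, 3, 2])"
proof -
  let ?c = "\<lambda>G :: nat edge_ordered_graph. G\<lparr>edge_order := (edge_order G)\<inverse>\<rparr>"
  let ?P = "\<lambda>as (G :: nat edge_ordered_graph). edge_ordered_graph G \<and> card (verts G) = n \<and> \<not> eo_contains G (eo_path as)"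
  have P: "?P [2, 1, 3] G \<longleftrightarrow> ?P [1, 3, 2] (?c G)" for G
    using eo_contains_path_213_converse[of G] by (auto simp: edge_ordered_graph_converse)
  have "{card (edges G) | G. ?P [2, 1, 3] G} = {card (edges G) | G. ?P [1, 3, 2] G}"
  proof (intro equalityI subsetI; elim CollectE exE conjE)
    fix k and G :: "nat edge_ordered_graph" assume "k = card (edges G)" "edge_ordered_graph G" "card (verts G) = n"
      "\<not> eo_contains G (eo_path [2, 1, 3])"
    then have "k = card (edges (?c G)) \<and> ?P [1, 3, 2] (?c G)"
      using P[of "G"] by auto
    then show "k \<in> {card (edges G) | G. ?P [1, 3, 2] G}" by blast
  next
    fix k and G :: "nat edge_ordered_graph" assume "k = card (edges G)" "edge_ordered_graph G" "card (verts G) = n"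
      "\<not> eo_contains G (eo_path [1, 3, 2])"
    then have "k = card (edges (?c G)) \<and> ?P [2, 1, 3] (?c G)"
      using P[of "?c G"] by auto
    then show "k \<in> {card (edges G) | G. ?P [2, 1, 3] G}" by blast
  qed
  then show ?thesis unfolding ex_less_def by simp
qed

section \<open>Upper bound by weights\<close>

abbreviation degree :: "'a set set \<Rightarrow> 'a \<Rightarrow> nat" where
  "degree E v \<equiv> card {e \<in> E. v \<in> e}"

text \<open>The edge order enters only through the last hypothesis, which supplies an edge to
  delete. It ranges over all nonempty subsets of \<open>E\<close> so that it passes to the smaller
  edge set in the induction. The weights of degrees 0, 1, 2 are 0, 2, 3, and they stay at 3
  afterwards; the \<open>of_bool\<close> term records the extra unit gained with the first vertex of
  degree two.\<close>

lemma weight_bound_of_peeling: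
  assumes "finite V" "E \<subseteq> {e. e \<subseteq> V \<and> card e = 2}" "E \<noteq> {}"
    and "\<And>F. F \<subseteq> E \<Longrightarrow> F \<noteq> {} \<Longrightarrow> \<exists>x y z. y \<noteq> z \<and> {y, z} \<in> F \<and>
      ({e \<in> F - {{y, z}}. y \<in> e} = {} \<or>
       {e \<in> F - {{y, z}}. y \<in> e} = {{x, y}} \<and> {e \<in> F - {{y, z}}. z \<in> e} = {{x, z}})"
  shows "2 * card E + 2 + of_bool (\<exists>v\<in>V. 2 \<le> degree E v) \<le> (\<Sum>v\<in>V. min 3 (2 * degree E v))"
proof -
  have "finite E" by (rule finite_subset[of _ "Pow V"]) (use assms in auto)
  then show ?thesis using assms(2-)
  proof (induction E rule: finite_psubset_induct)
    case (psubset E)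
    obtain x y z where yz: "y \<noteq> z" "{y, z} \<in> E" and
      peel: "{e \<in> E - {{y, z}}. y \<in> e} = {} \<or>
       {e \<in> E - {{y, z}}. y \<in> e} = {{x, y}} \<and> {e \<in> E - {{y, z}}. z \<in> e} = {{x, z}}"
      using psubset.prems(3)[OF subset_refl psubset.prems(2)] by (elim exE conjE) (rule that)
    define E' where "E' = E - {{y, z}}"
    have card: "card E = Suc (card E')"
      unfolding E'_def using psubset.hyps yz(2) by (simp only: card.remove)
    have V: "y \<in> V" "z \<in> V" using psubset.prems(1) yz(2) by auto
    have fin: "finite E'" using psubset.hyps by (simp add: E'_def)
    have deg: "degree E v = degree E' v + of_bool (v \<in> {y, z})" for v
    proof -
      have "{e \<in> E. v \<in> e} = (if v \<in> {y, z} then insert {y, z} {e \<in> E'. v \<in> e} else {e \<in> E'. v \<in> e})"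
        using yz(2) by (auto simp: E'_def)
      moreover have "{y, z} \<notin> E'" by (simp add: E'_def)
      ultimately show ?thesis using fin by simp
    qed
    have split: "(\<Sum>v\<in>V. f v) = f y + f z + (\<Sum>v\<in>V - {y} - {z}. f v)" for f :: "'a \<Rightarrow> nat"
      using \<open>finite V\<close> V yz(1) by (simp add: sum.remove[of V y] sum.remove[of "V - {y}" z])
    have rest: "(\<Sum>v\<in>V - {y} - {z}. min 3 (2 * degree E v)) =
        (\<Sum>v\<in>V - {y} - {z}. min 3 (2 * degree E' v))"
      by (intro sum.cong) (auto simp: deg)
    have sumE: "(\<Sum>v\<in>V. min 3 (2 * degree E v)) =
        min 3 (2 * degree E' y + 2) + min 3 (2 * degree E' z + 2) +
        (\<Sum>v\<in>V - {y} - {z}. min 3 (2 * degree E' v))"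
      unfolding split rest by (simp add: deg)
    have sumE': "(\<Sum>v\<in>V. min 3 (2 * degree E' v)) =
        min 3 (2 * degree E' y) + min 3 (2 * degree E' z) +
        (\<Sum>v\<in>V - {y} - {z}. min 3 (2 * degree E' v))"
      by (rule split)
    show ?case
    proof (cases "E' = {}")
      case True
      \<comment> \<open>A single edge has two ends of weight 2, and the bound \<open>2 + 2\<close>
        holds with equality.\<close>
      have d0: "degree E' v = 0" for v using True by simp
      have "\<not> (\<exists>v\<in>V. 2 \<le> degree E v)" using True by (auto simp: deg)
      then show ?thesis unfolding sumE d0 using True card by simp
    next
      case False
      have "2 * card E' + 2 + of_bool (\<exists>v\<in>V. 2 \<le> degree E' v) \<le> (\<Sum>v\<in>V. min 3 (2 * degree E' v))"
      proof (rule psubset.IH)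
        show "E' \<subset> E" using yz(2) by (auto simp: E'_def)
        show "E' \<subseteq> {e. e \<subseteq> V \<and> card e = 2}" using psubset.prems(1) by (auto simp: E'_def)
        show "\<exists>x y z. y \<noteq> z \<and> {y, z} \<in> F \<and> ({e \<in> F - {{y, z}}. y \<in> e} = {} \<or>
            {e \<in> F - {{y, z}}. y \<in> e} = {{x, y}} \<and> {e \<in> F - {{y, z}}. z \<in> e} = {{x, z}})"
          if "F \<subseteq> E'" "F \<noteq> {}" for F
          using psubset.prems(3)[of F] that by (auto simp: E'_def)
      qed (fact False)
      note IH = this[unfolded sumE']
      from peel show ?thesis
      proof
        assume "{e \<in> E - {{y, z}}. y \<in> e} = {}"
        then have y0: "degree E' y = 0" unfolding E'_def by (simp only: card.empty)
        \<comment> \<open>The vertex \<open>y\<close> ends with degree one, so only \<open>z\<close>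
          can newly reach degree two, and it does so exactly when its old degree is one.\<close>
        have big: "(\<exists>v\<in>V. 2 \<le> degree E v) \<longleftrightarrow> (\<exists>v\<in>V. 2 \<le> degree E' v) \<or> degree E' z = 1"
          (is "?L \<longleftrightarrow> ?R")
        proof
          assume ?L
          then obtain v where "v \<in> V" "2 \<le> degree E v" by blast
          moreover have "degree E' z = 1 \<or> 2 \<le> degree E' z" if "v = z"
            using \<open>2 \<le> degree E v\<close> unfolding deg that by simp linarith
          moreover have "v \<noteq> y" using \<open>2 \<le> degree E v\<close> y0 unfolding deg by auto
          ultimately show ?R by (cases "v = z") (auto simp: deg)
        next
          have "2 \<le> degree E v" if "2 \<le> degree E' v" for v using that unfolding deg by simp
          moreover have "2 \<le> degree E z" if "degree E' z = 1" using that unfolding deg by simp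
          moreover assume ?R
          ultimately show ?L using V(2) by blast
        qed
        \<comment> \<open>In every case \<open>y\<close> gains 2, which pays for the new edge. An
          isolated \<open>z\<close> gains 2 more; a \<open>z\<close> of degree one gains 1, which
          pays for a possible jump of the indicator; a \<open>z\<close> of larger degree gains
          nothing, but then the indicator was already 1.\<close>
        consider "degree E' z = 0" | "degree E' z = 1" | "2 \<le> degree E' z" by linarith
        then show ?thesis
        proof cases
          case 1
          then show ?thesis using IH unfolding sumE big card y0 by simp
        next
          case 2
          then show ?thesis using IH unfolding sumE big card y0 by simp
        next
          case 3
          then have "\<exists>v\<in>V. 2 \<le> degree E' v" using V by blast
          then show ?thesis using IH 3 unfolding sumE big card y0 by simp
        qed
      next
        assume "{e \<in> E - {{y, z}}. y \<in> e} = {{x, y}} \<and> {e \<in> E - {{y, z}}. z \<in> e} = {{x, z}}"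
        then have yE: "{e \<in> E'. y \<in> e} = {{x, y}}" and zE: "{e \<in> E'. z \<in> e} = {{x, z}}"
          unfolding E'_def by blast+
        then have d1: "degree E' y = 1" "degree E' z = 1" by simp_all
        have xE: "{x, y} \<in> E'" "{x, z} \<in> E'" using yE zE by blast+
        \<comment> \<open>Both \<open>y\<close> and \<open>z\<close> rise from weight 2 to 3, a gain
          of exactly 2. The indicator cannot jump, since \<open>x\<close> already has degree at
          least two in \<open>E'\<close>.\<close>
        have "card {{x, y}, {x, z}} = 2" using yz(1) by (auto simp: doubleton_eq_iff)
        moreover have "card {{x, y}, {x, z}} \<le> degree E' x" by (intro card_mono) (use xE fin in auto)
        moreover have "x \<in> V" using xE psubset.prems(1) by (auto simp: E'_def)
        ultimately have "\<exists>v\<in>V. 2 \<le> degree E' v" by auto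
        then show ?thesis using IH unfolding sumE d1 card by simp
      qed
    qed
  qed
qed

lemma linear_order_on_has_greatest:
  assumes "linear_order_on E r" "finite F" "F \<noteq> {}" "F \<subseteq> E"
  shows "\<exists>m\<in>F. \<forall>f\<in>F. (f, m) \<in> r"
  using assms(2-)
proof (induction F rule: finite_ne_induct)
  case (singleton a)
  then show ?case using assms(1) by (auto simp: order_on_defs refl_on_def)
next
  case (insert a F)
  then obtain m where m: "m \<in> F" "\<forall>f\<in>F. (f, m) \<in> r" by auto
  have "a \<in> E" "m \<in> E" "a \<noteq> m" using insert.prems insert.hyps m(1) by auto
  moreover have "refl_on E r" "trans r" "total_on E r"
    using assms(1) unfolding order_on_defs by auto
  ultimately have "(a, m) \<in> r \<or> (m, a) \<in> r" "(a, a) \<in> r" "(m, m) \<in> r" "trans r"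
    by (auto simp: total_on_def refl_on_def)
  then consider "(a, m) \<in> r" | "(m, a) \<in> r" "(a, a) \<in> r" "trans r" by blast
  then show ?case
  proof cases
    case 1
    then show ?thesis using m by blast
  next
    case 2
    then have "(f, a) \<in> r" if "f \<in> F" for f using m that by (meson transD)
    then show ?thesis using 2(2) by blast
  qed
qed

text \<open>The edge to peel is the largest edge \<open>{y, z}\<close> of \<open>F\<close>. If other
  edges of \<open>F\<close> leave both of its ends, they must all lead to one common vertex: two
  different far ends would give a path on four vertices whose middle edge is largest.\<close>

lemma peeling_of_avoiding_132:
  assumes G: "edge_ordered_graph G" and free: "\<not> eo_contains G (eo_path [1, 3, 2])"
    and F: "F \<subseteq> edges G" "F \<noteq> {}"
  shows "\<exists>x y z. y \<noteq> z \<and> {y, z} \<in> F \<and>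
    ({e \<in> F - {{y, z}}. y \<in> e} = {} \<or>
     {e \<in> F - {{y, z}}. y \<in> e} = {{x, y}} \<and> {e \<in> F - {{y, z}}. z \<in> e} = {{x, z}})"
proof -
  have lin: "linear_order_on (edges G) (edge_order G)" and fin: "finite (verts G)"
    and sub: "edges G \<subseteq> {e. e \<subseteq> verts G \<and> card e = 2}"
    using G unfolding edge_ordered_graph_def by auto
  have "finite F" by (rule finite_subset[of _ "Pow (verts G)"]) (use fin sub F in auto)
  then obtain m where m: "m \<in> F" "\<forall>f\<in>F. (f, m) \<in> edge_order G"
    using linear_order_on_has_greatest[OF lin _ F(2,1)] by blast
  have other: "\<exists>u. u \<noteq> v \<and> e = {v, u}" if "e \<in> F" "v \<in> e" for e v
  proof -
    have "card e = 2" using that F(1) sub by auto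
    then show ?thesis using that(2) by (auto simp: card_2_iff)
  qed
  obtain y z where yz: "m = {y, z}" "y \<noteq> z"
    using m(1) F(1) sub by (auto simp: card_2_iff)
  let ?Y = "{e \<in> F - {{y, z}}. y \<in> e}" and ?Z = "{e \<in> F - {{y, z}}. z \<in> e}"
  have Y: "\<exists>u. u \<noteq> y \<and> u \<noteq> z \<and> e = {u, y}" if "e \<in> ?Y" for e
    using other[of e y] that by auto
  have Z: "\<exists>u. u \<noteq> y \<and> u \<noteq> z \<and> e = {u, z}" if "e \<in> ?Z" for e
    using other[of e z] that by auto
  have same: "u = w" if "{u, y} \<in> ?Y" "{w, z} \<in> ?Z" for u w
  proof (rule ccontr)
    assume "u \<noteq> w"
    moreover have "u \<noteq> y" "u \<noteq> z" using Y[OF that(1)] by (auto simp: doubleton_eq_iff)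
    moreover have "w \<noteq> y" "w \<noteq> z" using Z[OF that(2)] by (auto simp: doubleton_eq_iff)
    ultimately have "distinct [u, y, z, w]" using yz(2) by auto
    moreover have "{u, y} \<in> edges G" "{y, z} \<in> edges G" "{z, w} \<in> edges G"
      "({u, y}, {y, z}) \<in> edge_order G" "({z, w}, {y, z}) \<in> edge_order G"
      using that m F(1) unfolding yz by (auto simp: insert_commute)
    ultimately show False using free unfolding eo_contains_path_132_iff[OF G] by blast
  qed
  consider "?Y = {}" | "?Z = {}" | e f where "e \<in> ?Y" "f \<in> ?Z" by blast
  then show ?thesis
  proof cases
    case 1
    then show ?thesis using yz m(1) by blast
  next
    case 2
    \<comment> \<open>The conclusion asks for isolation of the first named end, so \<open>y\<close>
      and \<open>z\<close> swap roles.\<close>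
    then have "{e \<in> F - {{z, y}}. z \<in> e} = {}" by (simp add: insert_commute)
    moreover have "{z, y} \<in> F" using yz m(1) by (simp add: insert_commute)
    ultimately show ?thesis using yz(2) by metis
  next
    case 3
    obtain x where x: "e = {x, y}" using Y[OF 3(1)] by blast
    obtain x' where x': "f = {x', z}" using Z[OF 3(2)] by blast
    have "x' = x" using same[of x x'] 3 unfolding x x' by auto
    \<comment> \<open>The edge \<open>{x, y}\<close> pins the far end of every edge in
      \<open>?Z\<close>; below, the edge at \<open>z\<close> does the same for
      \<open>?Y\<close>.\<close>
    have "?Z = {{x, z}}"
    proof (intro equalityI subsetI)
      fix g assume g: "g \<in> ?Z"
      then obtain w where w: "g = {w, z}" using Z by blast
      then show "g \<in> {{x, z}}" using same[of x w] g 3(1) unfolding x w by auto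
    next
      show "g \<in> ?Z" if "g \<in> {{x, z}}" for g using that 3(2) \<open>x' = x\<close> unfolding x' by simp
    qed
    moreover have "?Y = {{x, y}}"
    proof (intro equalityI subsetI)
      fix g assume g: "g \<in> ?Y"
      then obtain w where w: "g = {w, y}" using Y by blast
      then show "g \<in> {{x, y}}" using same[of w x] g 3(2) \<open>x' = x\<close> unfolding x' w by auto
    next
      show "g \<in> ?Y" if "g \<in> {{x, y}}" for g using that 3(1) unfolding x by simp
    qed
    ultimately show ?thesis using yz m(1) by blast
  qed
qed

text \<open>With \<open>m + 1\<close> vertices the total weight is at most \<open>3 * m + 3\<close>.
  A vertex of degree two makes the excess in the weight bound 3, which leaves \<open>3 * m\<close>
  for twice the number of edges.\<close>

lemma card_edges_avoiding_132:
  assumes G: "edge_ordered_graph G" and free: "\<not> eo_contains G (eo_path [1, 3, 2])"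
    and n: "card (verts G) = Suc m"
  shows "card (edges G) \<le> 3 * m div 2"
proof (cases "edges G = {}")
  case False
  have fin: "finite (verts G)" and sub: "edges G \<subseteq> {e. e \<subseteq> verts G \<and> card e = 2}"
    using G unfolding edge_ordered_graph_def by auto
  let ?d = "degree (edges G)"
  have bound: "2 * card (edges G) + 2 + of_bool (\<exists>v\<in>verts G. 2 \<le> ?d v) \<le>
      (\<Sum>v\<in>verts G. min 3 (2 * ?d v))"
    using fin sub False peeling_of_avoiding_132[OF G free] by (rule weight_bound_of_peeling)
  have three: "(\<Sum>v\<in>A. min 3 (2 * ?d v)) \<le> 3 * card A" for A
    using sum_bounded_above[of A "\<lambda>v. min 3 (2 * ?d v)" 3] by (simp add: mult.commute)
  have "2 * card (edges G) \<le> 3 * m"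
  proof (cases "\<exists>v\<in>verts G. 2 \<le> ?d v")
    case True
    then show ?thesis using bound three[of "verts G"] n by simp
  next
    case small: False
    \<comment> \<open>Now the excess is only 2, but any single vertex has degree at most one and
      hence weight at most 2, so the total weight is at most \<open>3 * m + 2\<close>.\<close>
    obtain v where v: "v \<in> verts G" using n by fastforce
    then have "?d v < 2" using small by (meson not_le)
    moreover have "(\<Sum>v\<in>verts G. min 3 (2 * ?d v)) =
        min 3 (2 * ?d v) + (\<Sum>v\<in>verts G - {v}. min 3 (2 * ?d v))"
      using fin v by (rule sum.remove)
    moreover have "card (verts G - {v}) = m" using fin v n by simp
    ultimately show ?thesis using bound three[of "verts G - {v}"] by simp
  qed
  then show ?thesis by simp
qed simp

section \<open>The extremal construction\<close>

lemma linear_order_on_inj_key: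
  fixes k :: "'a \<Rightarrow> 'b :: linorder"
  assumes "inj_on k A"
  shows "linear_order_on A {(a, b). a \<in> A \<and> b \<in> A \<and> k a \<le> k b}"
  using assms unfolding order_on_defs
  by (auto simp: refl_on_def trans_def antisym_def total_on_def inj_on_def)

text \<open>The friendship graph with centre 0. For odd \<open>m\<close> the vertex \<open>m\<close>
  belongs to no triangle and is a leaf at the centre.\<close>

definition windmill_edges :: "nat \<Rightarrow> nat set set" where
  "windmill_edges m = (\<lambda>i. {0, i}) ` {1..m} \<union> (\<lambda>k. {2 * k + 1, 2 * k + 2}) ` {..<m div 2}"

text \<open>Spokes receive the keys 1 to \<open>m\<close>, and the shift by \<open>m\<close> puts
  every outer edge above all of them. Within each of the two kinds an edge is determined by its
  maximum, so the key is injective on the edges.\<close>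

definition windmill_key :: "nat \<Rightarrow> nat set \<Rightarrow> nat" where
  "windmill_key m e = (if 0 \<in> e then Max e else m + Max e)"

definition windmill :: "nat \<Rightarrow> nat edge_ordered_graph" where
  "windmill m = \<lparr>verts = {..m}, edges = windmill_edges m,
     edge_order = {(e, f). e \<in> windmill_edges m \<and> f \<in> windmill_edges m \<and>
       windmill_key m e \<le> windmill_key m f}\<rparr>"

lemma card_windmill_edges: "card (windmill_edges m) = 3 * m div 2"
proof -
  have "card ((\<lambda>i. {0, i}) ` {1..m}) = m"
    by (subst card_image) (auto simp: inj_on_def doubleton_eq_iff)
  moreover have "card ((\<lambda>k. {2 * k + 1, 2 * k + 2}) ` {..<m div 2}) = m div 2"
    by (subst card_image) (auto simp: inj_on_def doubleton_eq_iff)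
  moreover have "(\<lambda>i. {0, i}) ` {1..m} \<inter> (\<lambda>k. {2 * k + 1, 2 * k + 2}) ` {..<m div 2} = {}"
    by (auto simp: doubleton_eq_iff)
  ultimately have "card (windmill_edges m) = m + m div 2"
    unfolding windmill_edges_def by (subst card_Un_disjoint) auto
  then show ?thesis by simp
qed

lemma edge_ordered_graph_windmill: "edge_ordered_graph (windmill m)"
proof -
  have "inj_on (windmill_key m) (windmill_edges m)"
    unfolding inj_on_def windmill_edges_def windmill_key_def by auto
  then have "linear_order_on (edges (windmill m)) (edge_order (windmill m))"
    unfolding windmill_def by (simp add: linear_order_on_inj_key)
  moreover have "edges (windmill m) \<subseteq> {e. e \<subseteq> verts (windmill m) \<and> card e = 2}"
    unfolding windmill_def windmill_edges_def by auto
  ultimately show ?thesis unfolding edge_ordered_graph_def by (simp add: windmill_def)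
qed

text \<open>Suppose the middle edge of a path is largest. If it is a spoke, both outer edges are
  spokes too, yet they are disjoint. If it is an outer edge of a triangle, each of its ends has only
  the centre as a further neighbour, so both ends of the path would be 0.\<close>

lemma windmill_avoids_132: "\<not> eo_contains (windmill m) (eo_path [1, 3, 2])"
proof
  assume "eo_contains (windmill m) (eo_path [1, 3, 2])"
  then obtain x y z w where d: "distinct [x, y, z, w]"
    and E: "{x, y} \<in> windmill_edges m" "{y, z} \<in> windmill_edges m" "{z, w} \<in> windmill_edges m"
    and o: "windmill_key m {x, y} \<le> windmill_key m {y, z}"
      "windmill_key m {z, w} \<le> windmill_key m {y, z}"
    unfolding eo_contains_path_132_iff[OF edge_ordered_graph_windmill]
    by (auto simp: windmill_def)
  have centre: "windmill_key m e \<le> m \<longleftrightarrow> 0 \<in> e" if "e \<in> windmill_edges m" for e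
    using that unfolding windmill_edges_def windmill_key_def by auto
  \<comment> \<open>Away from the centre each odd vertex is joined to its successor, so a neighbour
    other than 0 is a function of \<open>u\<close>.\<close>
  have leaf: "v = (if odd u then u + 1 else u - 1)"
    if uv: "{u, v} \<in> windmill_edges m" "0 \<notin> {u, v}" for u v
  proof -
    obtain k where "{u, v} = {2 * k + 1, 2 * k + 2}"
      using uv unfolding windmill_edges_def by blast
    then consider "u = 2 * k + 1" "v = 2 * k + 2" | "u = 2 * k + 2" "v = 2 * k + 1"
      unfolding doubleton_eq_iff by blast
    then show ?thesis by cases simp_all
  qed
  have partner: "v = v'"
    if "{u, v} \<in> windmill_edges m" "{u, v'} \<in> windmill_edges m" "0 \<notin> {u, v, v'}" for u v v'
    using leaf[OF that(1)] leaf[OF that(2)] that(3) by simp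
  \<comment> \<open>Spokes are exactly the edges with key at most \<open>m\<close>, so anything
    below a spoke is a spoke.\<close>
  have "0 \<in> {y, z} \<longrightarrow> 0 \<in> {x, y} \<and> 0 \<in> {z, w}"
    using centre[OF E(1)] centre[OF E(2)] centre[OF E(3)] o by (meson order_trans)
  then have "0 \<notin> {y, z}" using d by auto
  moreover from this have "x = 0" using partner[of y x z] E d by (auto simp: insert_commute)
  moreover have "w = 0" using partner[of z w y] E d \<open>0 \<notin> {y, z}\<close> by (auto simp: insert_commute)
  ultimately show False using d by simp
qed

section \<open>The extremal number\<close>

lemma ex_less_path_132: "ex_less (Suc m) (eo_path [1, 3, 2]) = 3 * m div 2"
  unfolding ex_less_def
proof (rule Max_eqI)
  show "finite {card (edges G) | G :: nat edge_ordered_graph.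
     edge_ordered_graph G \<and> card (verts G) = Suc m \<and> \<not> eo_contains G (eo_path [1, 3, 2])}"
    by (rule finite_ex_less_set)
  show "k \<le> 3 * m div 2" if "k \<in> {card (edges G) | G :: nat edge_ordered_graph.
     edge_ordered_graph G \<and> card (verts G) = Suc m \<and> \<not> eo_contains G (eo_path [1, 3, 2])}" for k
    using that card_edges_avoiding_132 by blast
  have "card (edges (windmill m)) = 3 * m div 2" "card (verts (windmill m)) = Suc m"
    by (simp_all add: windmill_def card_windmill_edges)
  then show "3 * m div 2 \<in> {card (edges G) | G :: nat edge_ordered_graph.
     edge_ordered_graph G \<and> card (verts G) = Suc m \<and> \<not> eo_contains G (eo_path [1, 3, 2])}"
    using edge_ordered_graph_windmill windmill_avoids_132 by (metis (mono_tags, lifting) mem_Collect_eq)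
qed

theorem theorem4p6:
  fixes n :: nat
  assumes "n \<ge> 1"
  shows "int (ex_less n (eo_path [1, 3, 2])) = \<lfloor>(3 / 2 :: real) * (real n - 1)\<rfloor> \<and>
         int (ex_less n (eo_path [2, 1, 3])) = \<lfloor>(3 / 2 :: real) * (real n - 1)\<rfloor>"
proof -
  obtain m where m: "n = Suc m" using assms by (cases n) auto
  have "(3 / 2 :: real) * (real n - 1) = real (3 * m) / real 2" by (simp add: m)
  \<comment> \<open>The floor of a real quotient of two naturals is their natural-number
    quotient.\<close>
  then have "\<lfloor>(3 / 2 :: real) * (real n - 1)\<rfloor> = int (3 * m div 2)"
    by (simp only: floor_divide_of_nat_eq)
  then show ?thesis by (simp only: ex_less_path_213_eq_132 m ex_less_path_132)
qed

end
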